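(* For every integer $d \ge 2$ and every $\epsilon > 0$, there exists a family $\mathcal{P}$ of $d$-dimensional 0-1 matrices such that $\operatorname{sat}(n,\mathcal{P},d) = O(1)$ and $\operatorname{ex}(n, \mathcal{P}, d) = \Omega(n^{d-\epsilon})$.
   Context: A $d$-dimensional 0-1 matrix $A$ contains a $d$-dimensional 0-1 matrix $P$ if $A$ has a submatrix (obtained by restricting each of the $d$ coordinates to a subset of its range) of the same dimensions as $P$ that can be turned into $P$ by changing any number of $1$-entries to $0$-entries; otherwise $A$ avoids $P$. A matrix $A$ is $\mathcal{P}$-saturated if $A$ avoids every element of $\mathcal{P}$ and changing any $0$-entry of $A$ to a $1$-entry produces a matrix that contains some element of $\mathcal{P}$. $\operatorname{sat}(n,\mathcal{P},d)$ is the minimum possible number of $1$-entries in a $\mathcal{P}$-saturated $d$-dimensional $n\times\dots\times n$ 0-1 matrix, and $\operatorname{ex}(n,\mathcal{P},d)$ is the maximum possible number of $1$-entries in a $d$-dimensional $n\times\dots\times n$ 0-1 matrix that avoids every element of $\mathcal{P}$. Asymptotics are for $n\to\infty$ with $\mathcal{P}$, $d$, $\epsilon$ fixed. *)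

theory Defs
  imports Complex_Main "HOL-Library.FuncSet" "HOL-Library.Landau_Symbols"
begin

text \<open>
  Coordinates are numbered \<open>0, \<dots>, d - 1\<close> and positions along each of them start at \<open>0\<close>.
  Shapes, positions and entries are extensional functions, so that two well-formed matrices are
  the same matrix iff they are equal in HOL.
\<close>

datatype mat01 = Mat01 (shape: "nat \<Rightarrow> nat") (entry: "(nat \<Rightarrow> nat) \<Rightarrow> nat")

definition index_set :: "nat \<Rightarrow> (nat \<Rightarrow> nat) \<Rightarrow> (nat \<Rightarrow> nat) set" where
  "index_set d s = (\<Pi>\<^sub>E i\<in>{..<d}. {..<s i})"

definition is_mat01 :: "nat \<Rightarrow> mat01 \<Rightarrow> bool" where
  "is_mat01 d A \<longleftrightarrow>
     shape A \<in> {..<d} \<rightarrow>\<^sub>E {1..} \<and> entry A \<in> index_set d (shape A) \<rightarrow>\<^sub>E {0, 1}"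

definition weight :: "nat \<Rightarrow> mat01 \<Rightarrow> nat" where
  "weight d A = card {x \<in> index_set d (shape A). entry A x = 1}"

text \<open>
  Restriction of coordinate \<open>i\<close> to the subset \<open>S i\<close> of its range: position \<open>k\<close> of the
  submatrix along coordinate \<open>i\<close> is the \<open>k\<close>-th smallest element of \<open>S i\<close>.
\<close>

definition submatrix :: "nat \<Rightarrow> mat01 \<Rightarrow> (nat \<Rightarrow> nat set) \<Rightarrow> mat01" where
  "submatrix d A S =
     Mat01 (\<lambda>i\<in>{..<d}. card (S i))
           (\<lambda>x\<in>index_set d (\<lambda>i. card (S i)).
              entry A (\<lambda>i\<in>{..<d}. sorted_list_of_set (S i) ! x i))"

definition turns_into :: "nat \<Rightarrow> mat01 \<Rightarrow> mat01 \<Rightarrow> bool" where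
  "turns_into d B P \<longleftrightarrow>
     shape B = shape P \<and>
     (\<forall>x \<in> index_set d (shape P). entry B x \<noteq> entry P x \<longrightarrow> entry B x = 1 \<and> entry P x = 0)"

definition contains_mat :: "nat \<Rightarrow> mat01 \<Rightarrow> mat01 \<Rightarrow> bool" where
  "contains_mat d A P \<longleftrightarrow>
     (\<exists>S. (\<forall>i<d. S i \<subseteq> {..<shape A i}) \<and> turns_into d (submatrix d A S) P)"

definition avoids_family :: "nat \<Rightarrow> mat01 set \<Rightarrow> mat01 \<Rightarrow> bool" where
  "avoids_family d \<P> A \<longleftrightarrow> (\<forall>P\<in>\<P>. \<not> contains_mat d A P)"

definition set_one :: "mat01 \<Rightarrow> (nat \<Rightarrow> nat) \<Rightarrow> mat01" where
  "set_one A x = Mat01 (shape A) ((entry A)(x := 1))"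

definition saturated :: "nat \<Rightarrow> mat01 set \<Rightarrow> mat01 \<Rightarrow> bool" where
  "saturated d \<P> A \<longleftrightarrow>
     avoids_family d \<P> A \<and>
     (\<forall>x \<in> index_set d (shape A). entry A x = 0 \<longrightarrow> (\<exists>P\<in>\<P>. contains_mat d (set_one A x) P))"

definition cube_mats :: "nat \<Rightarrow> nat \<Rightarrow> mat01 set" where
  "cube_mats d n = {A. is_mat01 d A \<and> shape A = (\<lambda>i\<in>{..<d}. n)}"

text \<open>
  The sets of weights below are finite, so the infimum and supremum are a minimum and a maximum
  whenever the sets are nonempty. If no matrix avoids the family then \<open>ex_num\<close> is \<open>0\<close>, so an
  eventually positive lower bound on \<open>ex_num\<close> entails that avoiding matrices exist for all large
  \<open>n\<close>; one of maximum weight is saturated, so \<open>sat_num\<close> is then a genuine minimum too.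
\<close>

definition sat_num :: "nat \<Rightarrow> mat01 set \<Rightarrow> nat \<Rightarrow> nat" where
  "sat_num n \<P> d = Inf (weight d ` {A \<in> cube_mats d n. saturated d \<P> A})"

definition ex_num :: "nat \<Rightarrow> mat01 set \<Rightarrow> nat \<Rightarrow> nat" where
  "ex_num n \<P> d = Sup (weight d ` {A \<in> cube_mats d n. avoids_family d \<P> A})"

end

theory Submission
  imports Defs
begin

text \<open>
  Let \<open>J\<close> be the all-ones cube of side \<open>m\<close>. The family consists of the matrices of side lengths
  \<open>m\<close> or \<open>m + 1\<close> that have \<open>J\<close> in the corner at the origin and at least one further \<open>1\<close>-entry.
  The matrix with \<open>J\<close> in the corner and zeros elsewhere is saturated: a strictly increasing
  map cannot move the further \<open>1\<close>-entry into the corner, while any added \<open>1\<close>-entry, together with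
  \<open>J\<close>, spans a member of the family. On the other hand each member contains \<open>J\<close>, so the
  extremal number is at least that of \<open>J\<close>. The deletion method (keep each position with
  probability \<open>1/q\<close> where \<open>q\<close> is about \<open>2 n\<^sup>\<epsilon>\<close>, then destroy every copy of \<open>J\<close>) shows the
  latter to be of order at least \<open>n\<^bsup>d - \<epsilon>\<^esup>\<close> as soon as \<open>d \<le> \<epsilon> m\<close>.
\<close>

section \<open>The deletion method for uniform hypergraphs\<close>

text \<open>Counting replaces probability: in a uniformly random colouring with \<open>q\<close>
  colours, colour \<open>0\<close> means that a point is kept, so points are kept independently with
  probability \<open>1/q\<close>. Only the values on \<open>X - C\<close> remain free.\<close>

lemma card_colourings_zero_on:
  fixes X C :: "'a set" and q :: nat
  assumes "finite X" "C \<subseteq> X" "0 < q"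
  shows "real (card {f \<in> X \<rightarrow>\<^sub>E {..<q}. \<forall>x\<in>C. f x = 0}) = real q ^ card X / real q ^ card C"
proof -
  have "{f \<in> X \<rightarrow>\<^sub>E {..<q}. \<forall>x\<in>C. f x = 0} = (\<Pi>\<^sub>E x\<in>X. if x \<in> C then {0} else {..<q})"
    using assms by (fastforce simp: PiE_iff split: if_splits)
  then have "card {f \<in> X \<rightarrow>\<^sub>E {..<q}. \<forall>x\<in>C. f x = 0}
      = (\<Prod>x\<in>X. if x \<in> C then 1 else q)"
    using assms by (auto simp: card_PiE intro!: prod.cong)
  also have "\<dots> = q ^ card (X - C)"
  proof -
    have "(\<Prod>x\<in>X. if x \<in> C then 1 else q) = (\<Prod>x\<in>X - C. q)"
      using assms by (intro prod.mono_neutral_cong_right) auto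
    then show ?thesis by simp
  qed
  also have "card (X - C) = card X - card C"
    using assms by (meson card_Diff_subset finite_subset)
  finally show ?thesis
    using assms card_mono[of X C] by (simp only: of_nat_power) (simp add: power_diff)
qed

lemma sum_card_filter_swap:
  assumes "finite A" "finite B"
  shows "(\<Sum>a\<in>A. real (card {b \<in> B. R a b})) = (\<Sum>b\<in>B. real (card {a \<in> A. R a b}))"
proof -
  have "(\<Sum>a\<in>A. card {b \<in> B. R a b}) = (\<Sum>b\<in>B. card {a \<in> A. R a b})"
    using sum.swap_restrict[OF assms, of "\<lambda>_ _. 1::nat" R] by simp
  then show ?thesis
    by (simp flip: of_nat_sum)
qed

text \<open>On average over all colourings, the number of kept points minus the number of fully kept
  edges is the stated bound. Some colouring attains at least this; deleting one point from each
  surviving edge then costs at most one point per edge.\<close>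

lemma exists_large_independent_subset:
  fixes X :: "'a set" and F :: "'a set set" and k q :: nat
  assumes "finite X" and F: "\<And>C. C \<in> F \<Longrightarrow> C \<subseteq> X \<and> card C = k" and "0 < k" "0 < q"
  shows "\<exists>I\<subseteq>X. (\<forall>C\<in>F. \<not> C \<subseteq> I) \<and>
           real (card X) / real q - real (card F) / real q ^ k \<le> real (card I)"
proof -
  define Om where "Om = X \<rightarrow>\<^sub>E {..<q}"
  define ones where "ones f = {x \<in> X. f x = 0}" for f :: "'a \<Rightarrow> nat"
  define bad where "bad f = {C \<in> F. \<forall>x\<in>C. f x = 0}" for f :: "'a \<Rightarrow> nat"
  define avg where "avg = real (card X) / real q - real (card F) / real q ^ k"
  have finF: "finite F"
    using F assms(1) by (meson Pow_iff finite_Pow_iff finite_subset subsetI)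
  have finOm: "finite Om"
    using assms(1) by (auto simp: Om_def intro: finite_PiE)
  have "Om \<noteq> {}"
    using assms(4) by (auto simp: Om_def PiE_eq_empty_iff)
  have card_Om: "real (card Om) = real q ^ card X"
    using assms(1) by (simp add: Om_def card_PiE)
  have 1: "(\<Sum>f\<in>Om. real (card (ones f))) = real (card Om) * (real (card X) / real q)"
  proof -
    have "(\<Sum>f\<in>Om. real (card (ones f))) = (\<Sum>x\<in>X. real (card {f \<in> Om. f x = 0}))"
      unfolding ones_def using finOm assms(1) by (rule sum_card_filter_swap)
    also have "\<dots> = (\<Sum>x\<in>X. real q ^ card X / real q)"
      using card_colourings_zero_on[OF assms(1) _ assms(4), of "{_}"]
      by (intro sum.cong) (auto simp: Om_def)
    finally show ?thesis by (simp add: card_Om)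
  qed
  have 2: "(\<Sum>f\<in>Om. real (card (bad f))) = real (card Om) * (real (card F) / real q ^ k)"
  proof -
    have "(\<Sum>f\<in>Om. real (card (bad f))) = (\<Sum>C\<in>F. real (card {f \<in> Om. \<forall>x\<in>C. f x = 0}))"
      unfolding bad_def using finOm finF by (rule sum_card_filter_swap)
    also have "\<dots> = (\<Sum>C\<in>F. real q ^ card X / real q ^ k)"
      using card_colourings_zero_on[OF assms(1) _ assms(4)] F
      by (intro sum.cong) (auto simp: Om_def)
    finally show ?thesis by (simp add: card_Om)
  qed
  \<comment> \<open>\<open>1\<close> and \<open>2\<close> give the mean of the difference over
    \<open>Om\<close>, and not every value can lie below the mean.\<close>
  have "\<exists>f\<in>Om. avg \<le> real (card (ones f)) - real (card (bad f))"
  proof (rule ccontr)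
    assume "\<not> ?thesis"
    then have "(\<Sum>f\<in>Om. real (card (ones f)) - real (card (bad f))) < (\<Sum>f\<in>Om. avg)"
      using finOm \<open>Om \<noteq> {}\<close> by (intro sum_strict_mono) auto
    then show False
      by (simp add: sum_subtractf 1 2 avg_def algebra_simps)
  qed
  then obtain f where f: "avg \<le> real (card (ones f)) - real (card (bad f))"
    by blast
  \<comment> \<open>One point is removed from each surviving edge. An edge inside \<open>I\<close>
    would consist of kept points, hence lie in \<open>bad f\<close>, and yet have lost its chosen
    point; \<open>0 < k\<close> makes that choice possible.\<close>
  define I where "I = ones f - (\<lambda>C. SOME x. x \<in> C) ` bad f"
  have "\<not> C \<subseteq> I" if "C \<in> F" for C
  proof
    assume "C \<subseteq> I"
    then have "C \<in> bad f"
      using that by (auto simp: bad_def I_def ones_def)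
    moreover have "C \<noteq> {}"
      using F[OF that] assms(3) by auto
    then have "(SOME x. x \<in> C) \<in> C"
      by (rule some_in_eq[THEN iffD2])
    ultimately show False
      using \<open>C \<subseteq> I\<close> by (auto simp: I_def)
  qed
  moreover have "avg \<le> real (card I)"
  proof -
    have "finite (bad f)"
      using finF by (simp add: bad_def)
    then have "card (ones f) - card ((\<lambda>C. SOME x. x \<in> C) ` bad f) \<le> card I"
      and "card ((\<lambda>C. SOME x. x \<in> C) ` bad f) \<le> card (bad f)"
      unfolding I_def by (auto intro: diff_card_le_card_Diff card_image_le)
    with f show ?thesis by linarith
  qed
  moreover have "I \<subseteq> X"
    by (auto simp: I_def ones_def)
  ultimately show ?thesis
    unfolding avg_def by blast
qed

section \<open>Dense sets of positions without a full box\<close>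

lemma index_set_iff:
  "y \<in> index_set d s \<longleftrightarrow> y \<in> extensional {..<d} \<and> (\<forall>i<d. y i < s i)"
  by (auto simp: index_set_def PiE_iff)

lemma index_set_restrict [simp]: "index_set d (restrict s {..<d}) = index_set d s"
  unfolding index_set_def by (rule PiE_cong) auto

lemma finite_index_set [simp]: "finite (index_set d s)"
  unfolding index_set_def by (rule finite_PiE) auto

lemma card_index_set_const [simp]: "card (index_set d (\<lambda>_. n)) = n ^ d"
  by (simp add: index_set_def card_PiE)

text \<open>The edges of the hypergraph are the boxes with all sides of size \<open>m\<close>: each
  has \<open>m ^ d\<close> points, and there are at most \<open>(n choose m) ^ d\<close> of
  them.\<close>

lemma exists_large_box_free_set:
  fixes d m n q :: nat
  assumes "0 < m" "0 < q"
  shows "\<exists>I\<subseteq>index_set d (\<lambda>_. n).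
     (\<forall>T. (\<forall>i<d. T i \<subseteq> {..<n} \<and> card (T i) = m) \<longrightarrow> \<not> Pi\<^sub>E {..<d} T \<subseteq> I) \<and>
     real n ^ d / real q - real n ^ (m * d) / real q ^ (m ^ d) \<le> real (card I)"
proof -
  define X where "X = index_set d (\<lambda>_. n)"
  define \<T> where "\<T> = {..<d} \<rightarrow>\<^sub>E {U. U \<subseteq> {..<n} \<and> card U = m}"
  define F where "F = Pi\<^sub>E {..<d} ` \<T>"
  have "finite X" and card_X: "card X = n ^ d"
    by (simp_all add: X_def)
  have "C \<subseteq> X \<and> card C = m ^ d" if C: "C \<in> F" for C
  proof -
    obtain T where T: "T \<in> \<T>" "C = Pi\<^sub>E {..<d} T"
      using C unfolding F_def by blast
    then have "C \<subseteq> X"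
      unfolding X_def index_set_def by (auto simp: \<T>_def intro!: PiE_mono)
    moreover have "card C = (\<Prod>i<d. m)"
      using T by (auto simp: card_PiE \<T>_def PiE_iff intro!: prod.cong)
    ultimately show ?thesis by simp
  qed
  from exists_large_independent_subset[OF \<open>finite X\<close>, of F "m ^ d" q, OF this _ assms(2)]
  obtain I where I: "I \<subseteq> X" "\<forall>C\<in>F. \<not> C \<subseteq> I"
      "real (card X) / real q - real (card F) / real q ^ (m ^ d) \<le> real (card I)"
    using assms(1) by auto
  have "card F \<le> card \<T>"
    unfolding F_def \<T>_def by (intro card_image_le finite_PiE) auto
  also have "\<dots> = (n choose m) ^ d"
    by (simp add: \<T>_def card_PiE n_subsets)
  \<comment> \<open>For \<open>m > n\<close> the binomial coefficient is \<open>0\<close>, which the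
    power estimate does not cover.\<close>
  also have "\<dots> \<le> (n ^ m) ^ d"
    by (cases "m \<le> n") (auto intro!: power_mono binomial_le_pow simp: binomial_eq_0)
  finally have "real (card F) \<le> real n ^ (m * d)"
    by (simp add: power_mult flip: of_nat_power)
  then have "real (card F) / real q ^ (m ^ d) \<le> real n ^ (m * d) / real q ^ (m ^ d)"
    by (intro divide_right_mono) auto
  with I(3) have "real n ^ d / real q - real n ^ (m * d) / real q ^ (m ^ d) \<le> real (card I)"
    by (simp add: card_X)
  moreover have "\<not> Pi\<^sub>E {..<d} T \<subseteq> I" if T: "\<forall>i<d. T i \<subseteq> {..<n} \<and> card (T i) = m" for T
  proof -
    \<comment> \<open>The sides indexed by \<open>\<T>\<close> are extensional whereas
      \<open>T\<close> is arbitrary; the box depends only on \<open>T\<close> below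
      \<open>d\<close>.\<close>
    have "restrict T {..<d} \<in> \<T>"
      using T by (auto simp: \<T>_def)
    moreover have "Pi\<^sub>E {..<d} T = Pi\<^sub>E {..<d} (restrict T {..<d})"
      by (rule PiE_cong) auto
    ultimately show ?thesis
      using I(2) by (auto simp: F_def)
  qed
  ultimately show ?thesis
    using I(1) unfolding X_def by blast
qed

text \<open>With \<open>q\<close> close to \<open>2 * n powr \<epsilon>\<close>, the deletion loss
  is at most half of the main term \<open>n ^ d / q\<close>. This reduces to
  \<open>2 * n ^ (d * (m - 1)) \<le> q ^ K\<close> with \<open>K = m ^ d - 1\<close>. The remaining
  half, with \<open>q \<le> 3 * n powr \<epsilon>\<close>, yields the constant
  \<open>6\<close>.\<close>

lemma exists_dense_box_free_set:
  fixes d m n :: nat and \<epsilon> :: real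
  assumes "d \<ge> 2" "\<epsilon> > 0" "m \<ge> 2" "real d \<le> \<epsilon> * real m" "n \<ge> 1"
  shows "\<exists>I\<subseteq>index_set d (\<lambda>_. n).
     (\<forall>T. (\<forall>i<d. T i \<subseteq> {..<n} \<and> card (T i) = m) \<longrightarrow> \<not> Pi\<^sub>E {..<d} T \<subseteq> I) \<and>
     real n powr (real d - \<epsilon>) / 6 \<le> real (card I)"
proof -
  define q where "q = nat \<lceil>2 * real n powr \<epsilon>\<rceil>"
  define K where "K = m ^ d - 1"
  have n1: "1 \<le> real n powr \<epsilon>"
    using assms by (simp add: ge_one_powr_ge_zero)
  have q_lo: "2 * real n powr \<epsilon> \<le> real q"
    unfolding q_def by linarith
  have q_hi: "real q \<le> 3 * real n powr \<epsilon>"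
    unfolding q_def using n1 by linarith
  have "0 < q"
    using q_lo n1 by linarith
  \<comment> \<open>Here \<open>d \<ge> 2\<close> enters:
    \<open>K \<ge> m * m - 1 \<ge> m * (m - 1)\<close>, so \<open>d \<le> \<epsilon> * m\<close>
    gives \<open>d * (m - 1) \<le> \<epsilon> * K\<close>.\<close>
  have mm: "m * m \<le> m ^ d"
    using power_increasing[of 2 d m] assms by (simp add: power2_eq_square)
  have Km: "m * (m - 1) \<le> K"
    using mm assms(3) unfolding K_def by (simp add: algebra_simps)
  have "1 \<le> m * (m - 1)"
    using assms(3) by simp
  then have "1 \<le> K"
    using Km by linarith
  have mK: "m ^ d = Suc K"
    using assms(3) by (simp add: K_def)
  have "real d * real (m - 1) \<le> \<epsilon> * real m * real (m - 1)"
    using assms(4) by (intro mult_right_mono) auto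
  also have "\<dots> = \<epsilon> * real (m * (m - 1))"
    by simp
  also have "\<dots> \<le> \<epsilon> * real K"
    using Km assms(2) by (intro mult_left_mono) (auto simp flip: of_nat_mult)
  finally have expo: "real (d * (m - 1)) \<le> \<epsilon> * real K"
    by simp
  have "2 * real n ^ (d * (m - 1)) = 2 * real n powr real (d * (m - 1))"
    using assms(5) by (subst powr_realpow) auto
  also have "\<dots> \<le> 2 * real n powr (\<epsilon> * real K)"
    using expo assms(5) by (intro mult_left_mono powr_mono) auto
  \<comment> \<open>The factor \<open>2\<close> in \<open>q\<close> absorbs the leading
    \<open>2\<close>, because \<open>K \<ge> 1\<close>.\<close>
  also have "\<dots> \<le> 2 ^ K * real n powr (\<epsilon> * real K)"
    using power_increasing[OF \<open>1 \<le> K\<close>, of "2::real"] by (intro mult_right_mono) auto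
  also have "\<dots> = (2 * real n powr \<epsilon>) ^ K"
    using assms(5) by (simp add: power_mult_distrib powr_powr flip: powr_realpow)
  also have "\<dots> \<le> real q ^ K"
    using q_lo by (intro power_mono) auto
  finally have key: "2 * real n ^ (d * (m - 1)) \<le> real q ^ K" .
  have "m * d = d * (m - 1) + d"
    using assms(3) by (simp add: algebra_simps)
  then have "2 * real n ^ (m * d) = 2 * real n ^ (d * (m - 1)) * real n ^ d"
    by (simp only: power_add mult.assoc)
  also have "\<dots> \<le> real q ^ K * real n ^ d"
    using key by (intro mult_right_mono) auto
  finally have "real n ^ (m * d) / real q ^ (m ^ d) \<le> real n ^ d / (2 * real q)"
    using \<open>0 < q\<close> by (simp add: mK field_simps)
  moreover have "real n powr (real d - \<epsilon>) / 6 \<le> real n ^ d / (2 * real q)"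
  proof -
    have "real n powr (real d - \<epsilon>) / 6 = real n ^ d / (2 * (3 * real n powr \<epsilon>))"
      using assms(5) by (simp add: powr_diff powr_realpow)
    also have "\<dots> \<le> real n ^ d / (2 * real q)"
      using q_hi \<open>0 < q\<close> assms(5) by (intro divide_left_mono mult_pos_pos) auto
    finally show ?thesis .
  qed
  moreover have "real n ^ d / real q = 2 * (real n ^ d / (2 * real q))"
    by simp
  ultimately have "real n powr (real d - \<epsilon>) / 6
      \<le> real n ^ d / real q - real n ^ (m * d) / real q ^ (m ^ d)"
    by linarith
  then show ?thesis
    using exists_large_box_free_set[of m q d n] assms(3) \<open>0 < q\<close> by (meson order_trans pos2 less_le_trans)
qed

section \<open>Containment through increasing maps, and indicator matrices\<close>

text \<open>\<open>\<sigma> i\<close> enumerates \<open>S i\<close> in increasing order. A strictly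
  increasing sequence of naturals dominates its index, whence \<open>k \<le> \<sigma> i k\<close>.
  Only the 1-entries of \<open>P\<close> constrain \<open>A\<close>.\<close>

lemma contains_matE:
  assumes "contains_mat d A P"
  obtains \<sigma> where
    "\<And>i. i < d \<Longrightarrow> strict_mono_on {..<shape P i} (\<sigma> i)"
    "\<And>i k. i < d \<Longrightarrow> k < shape P i \<Longrightarrow> k \<le> \<sigma> i k \<and> \<sigma> i k < shape A i"
    "\<And>y. y \<in> index_set d (shape P) \<Longrightarrow> entry P y = 1 \<Longrightarrow>
       entry A (\<lambda>i\<in>{..<d}. \<sigma> i (y i)) = 1"
proof -
  obtain S where S: "\<forall>i<d. S i \<subseteq> {..<shape A i}" "turns_into d (submatrix d A S) P"
    using assms by (auto simp: contains_mat_def)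
  define \<sigma> where "\<sigma> i k = sorted_list_of_set (S i) ! k" for i k
  have sh: "shape P = (\<lambda>i\<in>{..<d}. card (S i))"
    using S(2) by (simp add: turns_into_def submatrix_def)
  have ix: "index_set d (shape P) = index_set d (\<lambda>i. card (S i))"
    unfolding index_set_def sh by (rule PiE_cong) auto
  have fin: "finite (S i)" if "i < d" for i
    using S(1) that finite_subset by blast
  show thesis
  proof
    fix i assume i: "i < d"
    show "strict_mono_on {..<shape P i} (\<sigma> i)"
      using i fin[OF i] sorted_wrt_nth_less[OF strict_sorted_list_of_set[of "S i"]]
      by (auto simp: strict_mono_on_def \<sigma>_def sh)
    fix k assume k: "k < shape P i"
    have "\<sigma> i k \<in> S i"
      unfolding \<sigma>_def using i k fin[OF i] nth_mem[of k "sorted_list_of_set (S i)"] by (simp add: sh)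
    then show "k \<le> \<sigma> i k \<and> \<sigma> i k < shape A i"
      using S(1) i k sorted_wrt_less_idx[OF strict_sorted_list_of_set[of "S i"], of k]
      by (auto simp: \<sigma>_def sh)
  next
    fix y assume y: "y \<in> index_set d (shape P)" "entry P y = 1"
    then have "entry (submatrix d A S) y = 1"
      using S(2) unfolding turns_into_def by (metis one_neq_zero)
    then show "entry A (\<lambda>i\<in>{..<d}. \<sigma> i (y i)) = 1"
      using y(1) by (simp add: submatrix_def \<sigma>_def ix)
  qed
qed

definition indicator_mat :: "nat \<Rightarrow> nat \<Rightarrow> (nat \<Rightarrow> nat) set \<Rightarrow> mat01" where
  "indicator_mat d n I =
     Mat01 (\<lambda>i\<in>{..<d}. n) (\<lambda>y\<in>index_set d (\<lambda>_. n). (if y \<in> I then 1 else 0))"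

lemma shape_indicator_mat [simp]: "shape (indicator_mat d n I) = (\<lambda>i\<in>{..<d}. n)"
  by (simp add: indicator_mat_def)

lemma entry_indicator_mat [simp]:
  "y \<in> index_set d (\<lambda>_. n) \<Longrightarrow> entry (indicator_mat d n I) y = (if y \<in> I then 1 else 0)"
  by (simp add: indicator_mat_def)

lemma indicator_mat_in_cube_mats: "n \<ge> 1 \<Longrightarrow> indicator_mat d n I \<in> cube_mats d n"
  by (auto simp: cube_mats_def is_mat01_def indicator_mat_def)

lemma weight_indicator_mat:
  "I \<subseteq> index_set d (\<lambda>_. n) \<Longrightarrow> weight d (indicator_mat d n I) = card I"
  unfolding weight_def by (intro arg_cong[where f = card]) (auto split: if_splits)

section \<open>The corner family and its saturated matrix\<close>

text \<open>Sides \<open>m\<close> and \<open>Suc m\<close> suffice, since the corner and one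
  further position use at most \<open>m + 1\<close> values of each coordinate. The all-ones cube of
  side \<open>m\<close> is not itself a member: it has no position outside the corner.\<close>

definition corner_family :: "nat \<Rightarrow> nat \<Rightarrow> mat01 set" where
  "corner_family d m = {P. is_mat01 d P \<and> (\<forall>i<d. shape P i \<in> {m, Suc m}) \<and>
     (\<forall>y\<in>index_set d (\<lambda>_. m). entry P y = 1) \<and>
     (\<exists>y\<in>index_set d (shape P) - index_set d (\<lambda>_. m). entry P y = 1)}"

text \<open>A copy of a member includes a copy of its all-ones corner, and the images of
  \<open>{..<m}\<close> under the maps \<open>\<sigma> i\<close> are the sides of a full box inside
  \<open>I\<close>.\<close>

lemma indicator_mat_avoids_corner_family:
  assumes "\<And>T. (\<And>i. i < d \<Longrightarrow> T i \<subseteq> {..<n} \<and> card (T i) = m) \<Longrightarrow> \<not> Pi\<^sub>E {..<d} T \<subseteq> I"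
  shows "avoids_family d (corner_family d m) (indicator_mat d n I)"
  unfolding avoids_family_def
proof (intro ballI notI)
  fix P assume P: "P \<in> corner_family d m" and "contains_mat d (indicator_mat d n I) P"
  from this(2) obtain \<sigma> where
    mono: "\<And>i. i < d \<Longrightarrow> strict_mono_on {..<shape P i} (\<sigma> i)" and
    range: "\<And>i k. i < d \<Longrightarrow> k < shape P i \<Longrightarrow>
      k \<le> \<sigma> i k \<and> \<sigma> i k < shape (indicator_mat d n I) i" and
    ones: "\<And>y. y \<in> index_set d (shape P) \<Longrightarrow> entry P y = 1 \<Longrightarrow>
      entry (indicator_mat d n I) (\<lambda>i\<in>{..<d}. \<sigma> i (y i)) = 1"
    by (rule contains_matE) blast
  have shP: "m \<le> shape P i" if "i < d" for i
    using P that by (auto simp: corner_family_def)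
  define T where "T i = \<sigma> i ` {..<m}" for i
  have "T i \<subseteq> {..<n} \<and> card (T i) = m" if i: "i < d" for i
  proof
    show "T i \<subseteq> {..<n}"
      using range[OF i] shP[OF i] i by (fastforce simp: T_def)
    have "inj_on (\<sigma> i) {..<m}"
      using strict_mono_on_imp_inj_on[OF mono[OF i]] shP[OF i] by (auto intro: inj_on_subset)
    then show "card (T i) = m"
      by (simp add: T_def card_image)
  qed
  moreover have "Pi\<^sub>E {..<d} T \<subseteq> I"
  proof
    fix z assume z: "z \<in> Pi\<^sub>E {..<d} T"
    then have "\<forall>i\<in>{..<d}. \<exists>k. k < m \<and> z i = \<sigma> i k"
      by (fastforce simp: T_def PiE_iff)
    then obtain y where y: "\<And>i. i < d \<Longrightarrow> y i < m \<and> z i = \<sigma> i (y i)"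
      by (metis lessThan_iff bchoice)
    \<comment> \<open>\<open>y\<close> is arbitrary from \<open>d\<close> on; the restriction makes
      it a position.\<close>
    define y' where "y' = restrict y {..<d}"
    have y'm: "y' \<in> index_set d (\<lambda>_. m)"
      using y by (auto simp: y'_def index_set_def)
    then have y'P: "y' \<in> index_set d (shape P)"
      using shP by (meson index_set_iff order_less_le_trans)
    have zy: "z = (\<lambda>i\<in>{..<d}. \<sigma> i (y' i))"
      using z y by (auto simp: y'_def PiE_iff extensional_def fun_eq_iff)
    have "z \<in> index_set d (\<lambda>_. n)"
      using range y'P by (auto simp: zy index_set_iff)
    moreover have "entry (indicator_mat d n I) z = 1"
      unfolding zy using y'm y'P P by (intro ones) (auto simp: corner_family_def)
    ultimately show "z \<in> I"
      by (auto split: if_splits)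
  qed
  ultimately show False
    using assms by blast
qed

lemma corner_mat_saturated:
  assumes "m \<le> n" "0 < m"
  shows "saturated d (corner_family d m) (indicator_mat d n (index_set d (\<lambda>_. m)))"
    (is "saturated d _ ?A")
  unfolding saturated_def
proof (intro conjI ballI impI)
  show "avoids_family d (corner_family d m) ?A"
    unfolding avoids_family_def
  proof (intro ballI notI)
    fix P assume P: "P \<in> corner_family d m" and "contains_mat d ?A P"
    from this(2) obtain \<sigma> where
      range: "\<And>i k. i < d \<Longrightarrow> k < shape P i \<Longrightarrow> k \<le> \<sigma> i k \<and> \<sigma> i k < shape ?A i" and
      ones: "\<And>y. y \<in> index_set d (shape P) \<Longrightarrow> entry P y = 1 \<Longrightarrow>
        entry ?A (\<lambda>i\<in>{..<d}. \<sigma> i (y i)) = 1"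
      by (rule contains_matE) blast
    obtain y where y: "y \<in> index_set d (shape P)" "y \<notin> index_set d (\<lambda>_. m)" "entry P y = 1"
      using P by (auto simp: corner_family_def)
    have "(\<lambda>i\<in>{..<d}. \<sigma> i (y i)) \<in> index_set d (\<lambda>_. n)"
      using y(1) range by (auto simp: index_set_iff)
    with ones[OF y(1,3)] have "(\<lambda>i\<in>{..<d}. \<sigma> i (y i)) \<in> index_set d (\<lambda>_. m)"
      by (auto split: if_splits)
    then have "\<sigma> i (y i) < m" if "i < d" for i
      using that by (simp add: index_set_iff)
    \<comment> \<open>From \<open>y i \<le> \<sigma> i (y i)\<close>: a position outside the corner
      cannot be mapped into it.\<close>
    then have "y i < m" if "i < d" for i
      using range[OF that, of "y i"] y(1) that by (meson index_set_iff order_le_less_trans)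
    with y(1,2) show False
      by (simp add: index_set_iff)
  qed
next
  fix x assume "x \<in> index_set d (shape ?A)" and x0: "entry ?A x = 0"
  then have x: "x \<in> index_set d (\<lambda>_. n)"
    by simp
  with x0 have xm: "x \<notin> index_set d (\<lambda>_. m)"
    by auto
  \<comment> \<open>\<open>S i\<close> has \<open>m\<close> or \<open>m + 1\<close> elements
    according to whether \<open>x i\<close> is already below \<open>m\<close>. In the second case
    \<open>x i\<close> is the largest and gets index \<open>m\<close>, so \<open>p\<close> is the
    place of \<open>x\<close> in the submatrix. Taking \<open>P\<close> to be the submatrix itself
    makes \<open>turns_into\<close> trivial.\<close>
  define S where "S i = insert (x i) {..<m}" for i
  define p where "p = (\<lambda>i\<in>{..<d}. min (x i) m)"
  define P where "P = submatrix d (set_one ?A x) S"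
  have finite_S: "finite (S i)" for i
    by (simp add: S_def)
  have card_S: "card (S i) = (if x i < m then m else Suc m)" for i
    by (simp add: S_def insert_absorb)
  have list_S: "sorted_list_of_set (S i) = (if x i < m then [0..<m] else [0..<m] @ [x i])" for i
  proof (cases "x i < m")
    case True
    then have "S i = {0..<m}" by (auto simp: S_def)
    with True show ?thesis by simp
  next
    case False
    then have "sorted_list_of_set (set ([0..<m] @ [x i])) = [0..<m] @ [x i]"
      by (intro sorted_list_of_set.idem_if_sorted_distinct) (auto simp: sorted_append)
    moreover have "set ([0..<m] @ [x i]) = S i"
      by (auto simp: S_def)
    ultimately show ?thesis using False by metis
  qed
  have nth_lt: "sorted_list_of_set (S i) ! k = k" if "k < m" for i k
    using that by (simp add: list_S nth_append)
  have nth_p: "sorted_list_of_set (S i) ! min (x i) m = x i" for i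
    by (simp add: list_S nth_append)
  have shP: "shape P = (\<lambda>i\<in>{..<d}. card (S i))"
    by (simp add: P_def submatrix_def)
  have entry_P: "entry P y = entry (set_one ?A x) (\<lambda>i\<in>{..<d}. sorted_list_of_set (S i) ! y i)"
    if "y \<in> index_set d (\<lambda>i. card (S i))" for y
    using that by (simp add: P_def submatrix_def)
  have S_sub: "S i \<subseteq> {..<n}" if "i < d" for i
    using x that assms(1) by (auto simp: S_def index_set_iff)
  have "P \<in> corner_family d m"
    unfolding corner_family_def
  proof (intro CollectI conjI)
    show "is_mat01 d P"
      unfolding is_mat01_def
    proof
      show "shape P \<in> {..<d} \<rightarrow>\<^sub>E {1..}"
        using assms(2) by (auto simp: shP card_S)
      have "entry P y \<in> {0, 1}" if y: "y \<in> index_set d (\<lambda>i. card (S i))" for y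
      proof -
        have "sorted_list_of_set (S i) ! y i \<in> S i" if "i < d" for i
          using y that nth_mem[of "y i" "sorted_list_of_set (S i)"]
          by (simp add: index_set_iff finite_S)
        then have "(\<lambda>i\<in>{..<d}. sorted_list_of_set (S i) ! y i) \<in> index_set d (\<lambda>_. n)"
          using S_sub by (auto simp: index_set_iff)
        then show ?thesis
          using entry_P[OF y] by (auto simp: set_one_def)
      qed
      moreover have "entry P \<in> extensional (index_set d (\<lambda>i. card (S i)))"
        by (simp add: P_def submatrix_def)
      ultimately show "entry P \<in> index_set d (shape P) \<rightarrow>\<^sub>E {0, 1}"
        unfolding shP index_set_restrict by (simp add: PiE_iff)
    qed
    show "\<forall>i<d. shape P i \<in> {m, Suc m}"
      by (simp add: shP card_S)
    show "\<forall>y\<in>index_set d (\<lambda>_. m). entry P y = 1"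
    proof
      fix y assume y: "y \<in> index_set d (\<lambda>_. m)"
      then have "(\<lambda>i\<in>{..<d}. sorted_list_of_set (S i) ! y i) = y"
        using nth_lt by (auto simp: index_set_iff extensional_def fun_eq_iff)
      moreover have "y \<in> index_set d (\<lambda>i. card (S i))" "y \<in> index_set d (\<lambda>_. n)"
        using y assms(1) by (auto simp: index_set_iff card_S less_SucI order_less_le_trans)
      ultimately show "entry P y = 1"
        using y entry_P by (simp add: set_one_def)
    qed
    show "\<exists>y\<in>index_set d (shape P) - index_set d (\<lambda>_. m). entry P y = 1"
    proof
      have "(\<lambda>i\<in>{..<d}. sorted_list_of_set (S i) ! p i) = x"
        using x nth_p by (auto simp: p_def index_set_iff extensional_def fun_eq_iff)
      moreover have p: "p \<in> index_set d (\<lambda>i. card (S i))"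
        by (simp add: p_def index_set_iff card_S)
      ultimately show "entry P p = 1"
        using entry_P by (simp add: set_one_def)
      \<comment> \<open>\<open>min (x i) m < m\<close> forces \<open>x i < m\<close>, so
        \<open>p\<close> in the corner would put \<open>x\<close> there too.\<close>
      show "p \<in> index_set d (shape P) - index_set d (\<lambda>_. m)"
        using p xm x by (auto simp: shP p_def index_set_iff)
    qed
  qed
  moreover have "contains_mat d (set_one ?A x) P"
    unfolding contains_mat_def P_def
    using S_sub by (intro exI[of _ S]) (auto simp: set_one_def turns_into_def)
  ultimately show "\<exists>P\<in>corner_family d m. contains_mat d (set_one ?A x) P"
    by blast
qed

section \<open>Bounds on the saturation and extremal numbers\<close>

lemma weight_le_of_cube_mats:
  assumes "A \<in> cube_mats d n"
  shows "weight d A \<le> n ^ d"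
proof -
  have "weight d A \<le> card (index_set d (\<lambda>_. n))"
    unfolding weight_def using assms by (intro card_mono) (auto simp: cube_mats_def)
  then show ?thesis by simp
qed

lemma sat_num_corner_family_le:
  assumes "m \<le> n" "0 < m"
  shows "sat_num n (corner_family d m) d \<le> m ^ d"
proof -
  let ?A = "indicator_mat d n (index_set d (\<lambda>_. m))"
  have "index_set d (\<lambda>_. m) \<subseteq> index_set d (\<lambda>_. n)"
    using assms(1) by (fastforce simp: index_set_iff)
  then have "weight d ?A = m ^ d"
    by (simp add: weight_indicator_mat)
  moreover have "sat_num n (corner_family d m) d \<le> weight d ?A"
    unfolding sat_num_def
    using assms corner_mat_saturated[OF assms] indicator_mat_in_cube_mats[of n]
    by (intro cInf_lower) auto
  ultimately show ?thesis by simp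
qed

lemma weight_le_ex_num:
  assumes "A \<in> cube_mats d n" "avoids_family d \<P> A"
  shows "weight d A \<le> ex_num n \<P> d"
  unfolding ex_num_def
proof (rule cSup_upper)
  \<comment> \<open>A supremum of naturals bounds its set from above only if the set is
    bounded.\<close>
  show "bdd_above (weight d ` {A \<in> cube_mats d n. avoids_family d \<P> A})"
    using weight_le_of_cube_mats by (intro bdd_aboveI[of _ "n ^ d"]) auto
qed (use assms in auto)

theorem proposition4p9:
  fixes d :: nat and \<epsilon> :: real
  assumes "d \<ge> 2" and "\<epsilon> > 0"
  shows "\<exists>\<P> :: mat01 set.
           (\<forall>P\<in>\<P>. is_mat01 d P) \<and>
           (\<lambda>n. real (sat_num n \<P> d)) \<in> O(\<lambda>n. 1) \<and>
           (\<lambda>n. real (ex_num n \<P> d)) \<in> \<Omega>(\<lambda>n. real n powr (real d - \<epsilon>))"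
proof -
  \<comment> \<open>The ceiling ensures \<open>d \<le> \<epsilon> * m\<close>; the \<open>2\<close>
    provides the \<open>m \<ge> 2\<close> of the density estimate when \<open>\<epsilon>\<close> is
    large.\<close>
  define m where "m = max 2 (nat \<lceil>real d / \<epsilon>\<rceil>)"
  have m2: "m \<ge> 2"
    by (simp add: m_def)
  have "real d / \<epsilon> \<le> real m"
    unfolding m_def by linarith
  then have dm: "real d \<le> \<epsilon> * real m"
    using assms(2) by (simp add: field_simps)
  have "\<forall>P\<in>corner_family d m. is_mat01 d P"
    by (auto simp: corner_family_def)
  moreover have "(\<lambda>n. real (sat_num n (corner_family d m) d)) \<in> O(\<lambda>n. 1)"
  \<comment> \<open>The corner fits into the cube only from \<open>n = m\<close> on.\<close>
  proof (rule bigoI[of _ "real (m ^ d)"], rule eventually_sequentiallyI[of m])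
    fix n assume "m \<le> n"
    then have "sat_num n (corner_family d m) d \<le> m ^ d"
      using m2 by (intro sat_num_corner_family_le) auto
    then show "norm (real (sat_num n (corner_family d m) d)) \<le> real (m ^ d) * norm (1::real)"
      by (simp flip: of_nat_power)
  qed
  moreover have "(\<lambda>n. real (ex_num n (corner_family d m) d))
      \<in> \<Omega>(\<lambda>n. real n powr (real d - \<epsilon>))"
  proof (rule landau_omega.bigI[of "1/6"], simp, rule eventually_sequentiallyI[of 1])
    fix n :: nat assume n: "1 \<le> n"
    obtain I where I: "I \<subseteq> index_set d (\<lambda>_. n)"
        "\<And>T. (\<And>i. i < d \<Longrightarrow> T i \<subseteq> {..<n} \<and> card (T i) = m) \<Longrightarrow> \<not> Pi\<^sub>E {..<d} T \<subseteq> I"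
        "real n powr (real d - \<epsilon>) / 6 \<le> real (card I)"
      using exists_dense_box_free_set[OF assms m2 dm n] by blast
    have "card I = weight d (indicator_mat d n I)"
      using I(1) by (simp add: weight_indicator_mat)
    also have "\<dots> \<le> ex_num n (corner_family d m) d"
      using n I(2) by (intro weight_le_ex_num indicator_mat_in_cube_mats
        indicator_mat_avoids_corner_family) auto
    finally show "norm (real (ex_num n (corner_family d m) d))
        \<ge> 1/6 * norm (real n powr (real d - \<epsilon>))"
      using I(3) by simp
  qed
  ultimately show ?thesis by blast
qed

end
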